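(* Let $(X,r)$ be a finite quantum binomial set with $|X|=n$, and let $\mathbf{k}$ be a field. Then $(X,r)$ is a symmetric set if and only if the associated quadratic algebra $\mathcal{A}=\mathcal{A}(\mathbf{k},X,r)$ satisfies $\dim_{\mathbf{k}}\mathcal{A}_3=\binom{n+2}{3}$.
   Context: A quadratic set $(X,r)$ is a nonempty set $X$ with a bijection $r:X\times X\to X\times X$, written $r(x,y)=({}^xy,x^y)$. It is nondegenerate if for each $x\in X$ the maps $y\mapsto{}^xy$ and $y\mapsto y^x$ are bijections of $X$; involutive if $r^2=\mathrm{id}$; square-free if $r(x,x)=(x,x)$ for all $x$. A quantum binomial set is a quadratic set that is nondegenerate, involutive and square-free. $(X,r)$ is a symmetric set if $r$ is involutive and satisfies the braid relation $r^{12}r^{23}r^{12}=r^{23}r^{12}r^{23}$ on $X\times X\times X$, where $r^{12}=r\times\mathrm{id}_X$, $r^{23}=\mathrm{id}_X\times r$. The associated quadratic algebra is $\mathcal{A}(\mathbf{k},X,r)=\mathbf{k}\langle X\rangle/(\Re)$, where $\Re=\{xy-y'x'\mid r(x,y)=(y',x')\ne(x,y)\}$; it is graded by length and $\mathcal{A}_3$ is its component of degree 3. *)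

theory Defs
  imports "HOL-Algebra.Embedded_Algebras" "HOL-Algebra.QuotRing" "HOL-Library.Poly_Mapping"
begin

section \<open>Quadratic sets\<close>

text \<open>
  The underlying set is a carrier \<open>X\<close> inside a type, and only the values of \<open>r\<close> on
  \<open>X \<times> X\<close> matter. With \<open>r(x,y) = (\<^sup>xy, x\<^sup>y)\<close>, the left action of \<open>x\<close> is
  \<open>y \<mapsto> fst (r (x, y))\<close>, and the right action \<open>y \<mapsto> y\<^sup>x\<close> is \<open>y \<mapsto> snd (r (y, x))\<close>.
\<close>

definition quadratic_set :: "'x set \<Rightarrow> ('x \<times> 'x \<Rightarrow> 'x \<times> 'x) \<Rightarrow> bool" where
  "quadratic_set X r \<longleftrightarrow> X \<noteq> {} \<and> bij_betw r (X \<times> X) (X \<times> X)"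

definition nondegenerate :: "'x set \<Rightarrow> ('x \<times> 'x \<Rightarrow> 'x \<times> 'x) \<Rightarrow> bool" where
  "nondegenerate X r \<longleftrightarrow>
     (\<forall>x\<in>X. bij_betw (\<lambda>y. fst (r (x, y))) X X \<and> bij_betw (\<lambda>y. snd (r (y, x))) X X)"

definition involutive :: "'x set \<Rightarrow> ('x \<times> 'x \<Rightarrow> 'x \<times> 'x) \<Rightarrow> bool" where
  "involutive X r \<longleftrightarrow> (\<forall>p\<in>X \<times> X. r (r p) = p)"

definition square_free :: "'x set \<Rightarrow> ('x \<times> 'x \<Rightarrow> 'x \<times> 'x) \<Rightarrow> bool" where
  "square_free X r \<longleftrightarrow> (\<forall>x\<in>X. r (x, x) = (x, x))"

definition quantum_binomial_set :: "'x set \<Rightarrow> ('x \<times> 'x \<Rightarrow> 'x \<times> 'x) \<Rightarrow> bool" where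
  "quantum_binomial_set X r \<longleftrightarrow>
     quadratic_set X r \<and> nondegenerate X r \<and> involutive X r \<and> square_free X r"

definition r12 :: "('x \<times> 'x \<Rightarrow> 'x \<times> 'x) \<Rightarrow> 'x \<times> 'x \<times> 'x \<Rightarrow> 'x \<times> 'x \<times> 'x" where
  "r12 r = (\<lambda>(x, y, z). case r (x, y) of (x', y') \<Rightarrow> (x', y', z))"

definition r23 :: "('x \<times> 'x \<Rightarrow> 'x \<times> 'x) \<Rightarrow> 'x \<times> 'x \<times> 'x \<Rightarrow> 'x \<times> 'x \<times> 'x" where
  "r23 r = (\<lambda>(x, y, z). case r (y, z) of (y', z') \<Rightarrow> (x, y', z'))"

definition braided :: "'x set \<Rightarrow> ('x \<times> 'x \<Rightarrow> 'x \<times> 'x) \<Rightarrow> bool" where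
  "braided X r \<longleftrightarrow>
     (\<forall>t\<in>X \<times> X \<times> X. r12 r (r23 r (r12 r t)) = r23 r (r12 r (r23 r t)))"

definition symmetric_set :: "'x set \<Rightarrow> ('x \<times> 'x \<Rightarrow> 'x \<times> 'x) \<Rightarrow> bool" where
  "symmetric_set X r \<longleftrightarrow> quadratic_set X r \<and> involutive X r \<and> braided X r"


section \<open>The free associative algebra\<close>

text \<open>
  The multiplication of \<^typ>\<open>'a \<Rightarrow>\<^sub>0 'b\<close> is convolution over an additively written, not
  necessarily commutative, monoid of exponents. The words over \<open>'x\<close> are therefore given
  their concatenation as \<open>+\<close>, so that \<open>'x word \<Rightarrow>\<^sub>0 'k\<close> is the monoid
  algebra of the free monoid. The wrapper avoids a global instance for lists.
\<close>

datatype 'x word = Word (letters: "'x list")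

instantiation word :: (type) monoid_add
begin

definition zero_word :: "'a word" where
  "zero_word = Word []"

definition plus_word :: "'a word \<Rightarrow> 'a word \<Rightarrow> 'a word" where
  "plus_word v w = Word (letters v @ letters w)"

instance
  by standard (simp_all add: zero_word_def plus_word_def)

end

definition free_algebra :: "'x set \<Rightarrow> ('x word \<Rightarrow>\<^sub>0 'k::field) ring" where
  "free_algebra X =
     \<lparr>carrier = {f. \<forall>w\<in>Poly_Mapping.keys f. letters w \<in> lists X},
      monoid.mult = (*), one = 1, zero = 0, add = (+)\<rparr>"

lemma ring_free_algebra: "ring (free_algebra X :: ('x word \<Rightarrow>\<^sub>0 'k::field) ring)"
proof (rule ringI)
  let ?F = "free_algebra X :: ('x word \<Rightarrow>\<^sub>0 'k) ring"
  have add: "f + g \<in> carrier ?F" if "f \<in> carrier ?F" "g \<in> carrier ?F" for f g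
  proof -
    have "letters w \<in> lists X" if "w \<in> Poly_Mapping.keys (f + g)" for w
      using subsetD[OF Poly_Mapping.keys_add that] \<open>f \<in> _\<close> \<open>g \<in> _\<close>
      unfolding free_algebra_def partial_object.simps mem_Collect_eq by blast
    then show ?thesis
      unfolding free_algebra_def partial_object.simps mem_Collect_eq by blast
  qed
  have mult: "f * g \<in> carrier ?F" if "f \<in> carrier ?F" "g \<in> carrier ?F" for f g
  proof -
    have "letters w \<in> lists X" if w: "w \<in> Poly_Mapping.keys (f * g)" for w
    proof -
      obtain u v where "w = u + v" "u \<in> Poly_Mapping.keys f" "v \<in> Poly_Mapping.keys g"
        using subsetD[OF keys_mult w] by blast
      moreover have "letters u \<in> lists X" "letters v \<in> lists X"
        using calculation \<open>f \<in> _\<close> \<open>g \<in> _\<close>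
        unfolding free_algebra_def partial_object.simps mem_Collect_eq by blast+
      ultimately show ?thesis
        by (simp add: plus_word_def)
    qed
    then show ?thesis
      unfolding free_algebra_def partial_object.simps mem_Collect_eq by blast
  qed
  show "abelian_group ?F"
  proof (rule abelian_groupI)
    fix f g assume "f \<in> carrier ?F" "g \<in> carrier ?F"
    from add[OF this] show "f \<oplus>\<^bsub>?F\<^esub> g \<in> carrier ?F"
      unfolding free_algebra_def by simp
  next
    fix f assume "f \<in> carrier ?F"
    then show "\<exists>g\<in>carrier ?F. g \<oplus>\<^bsub>?F\<^esub> f = \<zero>\<^bsub>?F\<^esub>"
      by (intro bexI[of _ "- f"]) (simp_all add: free_algebra_def)
  qed (simp_all add: free_algebra_def add_ac)
  show "Group.monoid ?F"
  proof (rule monoidI)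
    fix f g assume "f \<in> carrier ?F" "g \<in> carrier ?F"
    from mult[OF this] show "f \<otimes>\<^bsub>?F\<^esub> g \<in> carrier ?F"
      unfolding free_algebra_def by simp
  qed (simp_all add: free_algebra_def mult.assoc zero_word_def)
qed (simp_all add: free_algebra_def distrib_left distrib_right)

definition monomial :: "'x list \<Rightarrow> ('x word \<Rightarrow>\<^sub>0 'k::field)" where
  "monomial xs = Poly_Mapping.single (Word xs) 1"

definition homogeneous :: "'x set \<Rightarrow> nat \<Rightarrow> ('x word \<Rightarrow>\<^sub>0 'k::field) set" where
  "homogeneous X d =
     {f \<in> carrier (free_algebra X). \<forall>w\<in>Poly_Mapping.keys f. length (letters w) = d}"


section \<open>The associated quadratic algebra\<close>

definition quadratic_relations ::
  "'x set \<Rightarrow> ('x \<times> 'x \<Rightarrow> 'x \<times> 'x) \<Rightarrow> ('x word \<Rightarrow>\<^sub>0 'k::field) set" where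
  "quadratic_relations X r =
     {monomial [x, y] - monomial [y', x'] | x y y' x'.
        x \<in> X \<and> y \<in> X \<and> r (x, y) = (y', x') \<and> (y', x') \<noteq> (x, y)}"

definition relation_ideal ::
  "'x set \<Rightarrow> ('x \<times> 'x \<Rightarrow> 'x \<times> 'x) \<Rightarrow> ('x word \<Rightarrow>\<^sub>0 'k::field) set" where
  "relation_ideal X r = Idl\<^bsub>free_algebra X\<^esub> (quadratic_relations X r)"

definition quadratic_algebra ::
  "'x set \<Rightarrow> ('x \<times> 'x \<Rightarrow> 'x \<times> 'x) \<Rightarrow> ('x word \<Rightarrow>\<^sub>0 'k::field) set ring" where
  "quadratic_algebra X r = free_algebra X Quot relation_ideal X r"

definition residue_class ::
  "'x set \<Rightarrow> ('x \<times> 'x \<Rightarrow> 'x \<times> 'x) \<Rightarrow> ('x word \<Rightarrow>\<^sub>0 'k::field) \<Rightarrow> ('x word \<Rightarrow>\<^sub>0 'k) set" where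
  "residue_class X r f = relation_ideal X r +>\<^bsub>free_algebra X\<^esub> f"

text \<open>
  Dimensions in \<open>HOL-Algebra\<close> are taken over a subfield of the ambient ring. The field
  \<open>'k\<close> enters as the subfield \<open>k * 1\<close> of the algebra: the ideal is generated in degree
  two, so \<open>'k\<close> embeds, and left multiplication by the class of the constant
  \<open>c\<close> is scalar multiplication by \<open>c\<close>.
\<close>

definition scalars ::
  "'x set \<Rightarrow> ('x \<times> 'x \<Rightarrow> 'x \<times> 'x) \<Rightarrow> ('x word \<Rightarrow>\<^sub>0 'k::field) set set" where
  "scalars X r = range (\<lambda>c. residue_class X r (Poly_Mapping.single 0 c))"

definition graded_component ::
  "'x set \<Rightarrow> ('x \<times> 'x \<Rightarrow> 'x \<times> 'x) \<Rightarrow> nat \<Rightarrow> ('x word \<Rightarrow>\<^sub>0 'k::field) set set" where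
  "graded_component X r d = residue_class X r ` homogeneous X d"

end

theory Submission
  imports Defs "HOL-Library.Disjoint_Sets" "HOL-Library.Z2"
begin

text \<open>
  The relations identify words of the same length, so \<open>A\<^sub>d\<close> has as a basis the classes of words of
  length \<open>d\<close> under the rewriting \<open>x y \<mapsto> y' x'\<close> (\<open>dimension_graded_component\<close>). That words
  of one class agree in the algebra is clear. That different classes are linearly independent is seen
  by duality: a function on words that is constant on classes is a linear functional vanishing on
  the relation ideal, and the indicator of a class is such a function.

  In degree three the classes are the orbits of the two involutions \<open>a = r\<^sup>1\<^sup>2\<close> and
  \<open>b = r\<^sup>2\<^sup>3\<close> on \<open>X\<^sup>3\<close>. The fixed points are known: nondegeneracy and square-freeness
  give \<open>r(x,y) = (x,y)\<close> only for \<open>x = y\<close>, so \<open>a\<close> and \<open>b\<close> fix \<open>n\<^sup>2\<close> triples each and share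
  \<open>n\<close> fixed points. The same two properties show that \<open>a\<close> and \<open>b\<close> commute at a triple only
  if both fix it. If the braid relation holds, then \<open>a\<close> and \<open>b\<close> generate an action of the symmetric
  group on three letters, and Burnside's lemma gives \<open>(n\<^sup>3 + 3 n\<^sup>2 + 2 n) / 6\<close> orbits, which is the
  binomial coefficient.

  For the converse, each summand of the Burnside count is distributed over the orbits
  (\<open>orbit_weight\<close>). An orbit of two involutions is a path, whose two ends are fixed points of
  \<open>a\<close> or \<open>b\<close>, or a cycle without fixed points. Because \<open>a\<close> and \<open>b\<close> never commute away from
  common fixed points, a path has one point or at least three, and a cycle has at least six.
  Hence every orbit carries at least the weight that an orbit of the symmetric group carries,
  with equality exactly if the braid relation holds on it
  (\<open>orbit_weight_ge_and_eq_iff_braid\<close>). As the total weight is fixed, the number of orbits is at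
  most the binomial coefficient, and equals it exactly if the braid relation holds everywhere
  (\<open>card_orbits_eq_iff_braid\<close>).
\<close>

section \<open>Orbits of two involutions\<close>

lemma even_card_fixpoint_free_involution:
  assumes "\<And>x. x \<in> A \<Longrightarrow> f x \<in> A" and "\<And>x. x \<in> A \<Longrightarrow> f (f x) = x"
    and "\<And>x. x \<in> A \<Longrightarrow> f x \<noteq> x"
  shows "even (card A)"
proof -
  have "(\<Sum>x\<in>A. 1 :: bit) = 0"
    by (rule sum_involution_eq_0[of A "\<lambda>_. 1" f]) (use assms in auto)
  then show ?thesis
    by (cases "even (card A)") (auto simp: elim!: evenE oddE)
qed

text \<open>
  This is the parity argument that gives a path its second end: the points moved by an involution
  come in pairs.
\<close>

lemma even_card_add_card_fixpoints:
  assumes "finite A" and "\<And>x. x \<in> A \<Longrightarrow> f x \<in> A" and "\<And>x. x \<in> A \<Longrightarrow> f (f x) = x"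
  shows "even (card A + card {x \<in> A. f x = x})"
proof -
  have "even (card {x \<in> A. f x \<noteq> x})"
    using assms by (intro even_card_fixpoint_free_involution[of _ f]) auto
  moreover have "card A = card {x \<in> A. f x = x} + card {x \<in> A. f x \<noteq> x}"
    using assms(1) by (subst card_Un_disjoint[symmetric]) (auto intro: arg_cong[where f = card])
  ultimately show ?thesis by simp
qed

text \<open>
  Twice the contribution of a point to the Burnside count of an action of the symmetric group on three
  letters. The fixed points of the third transposition \<open>a b a\<close> are equinumerous with
  those of \<open>a\<close> and of \<open>b\<close>, which turns the three transpositions into \<open>3 / 2\<close> for \<open>a\<close>
  and \<open>3 / 2\<close> for \<open>b\<close>; under rigidity, each of the two 3-cycles fixes the common fixed points of \<open>a\<close> and \<open>b\<close> only.
  Doubling keeps the weights in the natural numbers, so the target value for an orbit is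
  \<open>2 * 6 = 12\<close>.
\<close>

definition orbit_weight :: "('a \<Rightarrow> 'a) \<Rightarrow> ('a \<Rightarrow> 'a) \<Rightarrow> 'a \<Rightarrow> nat" where
  "orbit_weight a b t = 2 + 3 * of_bool (a t = t) + 3 * of_bool (b t = t)
     + 4 * of_bool (a t = t \<and> b t = t)"

lemma sum_orbit_weight:
  assumes "finite A"
  shows "sum (orbit_weight a b) A = 2 * card A + 3 * card {t \<in> A. a t = t}
     + 3 * card {t \<in> A. b t = t} + 4 * card {t \<in> A. a t = t \<and> b t = t}"
  unfolding orbit_weight_def using assms
  by (simp only: sum.distrib sum_distrib_left[symmetric] sum_of_bool_eq of_nat_id
      sum_constant Int_def mem_Collect_eq mult.commute)

text \<open>
  Rigidity is what excludes short orbits: a path of two points and a cycle of two or four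
  points would contain a point that \<open>a\<close> and \<open>b\<close> do not both fix but at which they commute.
\<close>

locale rigid_involutions =
  fixes S :: "'a set" and a b :: "'a \<Rightarrow> 'a"
  assumes finite: "finite S"
    and a_closed: "\<And>t. t \<in> S \<Longrightarrow> a t \<in> S" and b_closed: "\<And>t. t \<in> S \<Longrightarrow> b t \<in> S"
    and a_a: "\<And>t. t \<in> S \<Longrightarrow> a (a t) = t" and b_b: "\<And>t. t \<in> S \<Longrightarrow> b (b t) = t"
    and rigid: "\<And>t. t \<in> S \<Longrightarrow> a (b t) = b (a t) \<Longrightarrow> a t = t \<and> b t = t"

text \<open>
  Transitivity is phrased through invariant subsets, so that an orbit is known as soon as
  an invariant set of explicitly listed points has been found in it.
\<close>

locale rigid_orbit = rigid_involutions +
  assumes nonempty: "S \<noteq> {}"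
    and transitive: "\<And>Q. Q \<subseteq> S \<Longrightarrow> Q \<noteq> {} \<Longrightarrow> (\<And>t. t \<in> Q \<Longrightarrow> a t \<in> Q \<and> b t \<in> Q) \<Longrightarrow> Q = S"
begin

lemma swapped_orbit: "rigid_orbit S b a"
  by unfold_locales
     (use finite a_closed b_closed a_a b_b nonempty transitive rigid in simp_all)

lemma common_fixpoint:
  assumes "t \<in> S" "a t = t" "b t = t"
  shows "sum (orbit_weight a b) S = 12" and "s \<in> S \<Longrightarrow> a (b (a s)) = b (a (b s))"
proof -
  have "S = {t}"
    using transitive[of "{t}"] assms by auto
  then show "sum (orbit_weight a b) S = 12" "s \<in> S \<Longrightarrow> a (b (a s)) = b (a (b s))"
    using assms by (auto simp: orbit_weight_def)
qed

text \<open>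
  Both \<open>a\<close> and \<open>b\<close> have as many fixed points as the orbit has points, modulo 2. If this
  number is odd, each of them has one; if it is even, the fixed points of \<open>a\<close> number at least two.
\<close>

lemma two_ends:
  assumes "t \<in> S" "a t = t"
  shows "2 \<le> card {t \<in> S. a t = t} + card {t \<in> S. b t = t}"
proof -
  have "{t \<in> S. a t = t} \<noteq> {}" using assms by blast
  then have "card {t \<in> S. a t = t} > 0" using finite by (simp add: card_gt_0_iff)
  moreover have "even (card S + card {t \<in> S. a t = t})"
    using finite a_closed a_a by (rule even_card_add_card_fixpoints)
  moreover have "even (card S + card {t \<in> S. b t = t})"
    using finite b_closed b_b by (rule even_card_add_card_fixpoints)
  ultimately show ?thesis by presburger
qed

text \<open>
  A path with end \<open>t\<close> begins with the three distinct points \<open>t\<close>, \<open>b t\<close>, \<open>a (b t)\<close>, and its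
  two ends add 6 to the weight. The bound 12 is attained exactly if the path stops after
  these points, that is, if \<open>b\<close> fixes the third; for \<open>a t = t\<close> this is
  the braid relation at \<open>t\<close>, and it implies the relation along the whole path.
\<close>

lemma path_orbit:
  assumes t: "t \<in> S" "a t = t" "b t \<noteq> t"
  shows "sum (orbit_weight a b) S \<ge> 12 \<and>
    (sum (orbit_weight a b) S = 12 \<longleftrightarrow> (\<forall>s\<in>S. a (b (a s)) = b (a (b s))))"
proof -
  let ?P = "{t, b t, a (b t)}"
  have P: "?P \<subseteq> S" using t a_closed b_closed by blast
  have abt: "a (b t) \<noteq> b t" using rigid[of t] t by auto
  moreover have "a (b t) \<noteq> t" using t a_a b_closed by metis
  ultimately have card_P: "card ?P = 3" using t by auto
  have ge: "sum (orbit_weight a b) S \<ge> 2 * card S + 6"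
    using two_ends[OF t(1,2)] sum_orbit_weight[OF finite, of a b] by linarith
  moreover have "card S \<ge> 3" using card_mono[OF finite P] card_P by simp
  moreover have "sum (orbit_weight a b) S = 12 \<longleftrightarrow> b (a (b t)) = a (b t)"
  proof
    assume "sum (orbit_weight a b) S = 12"
    then have "card S = 3" using ge \<open>card S \<ge> 3\<close> by linarith
    then have S: "S = ?P" using card_subset_eq[OF finite P] card_P by simp
    have "b (a (b t)) \<in> S" using t a_closed b_closed by blast
    moreover have "b (a (b t)) \<noteq> t" using abt t a_closed b_closed b_b by metis
    moreover have "b (a (b t)) \<noteq> b t" using \<open>a (b t) \<noteq> t\<close> t a_closed b_closed b_b by metis
    ultimately show "b (a (b t)) = a (b t)" using S by blast
  next
    assume eq: "b (a (b t)) = a (b t)"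
    have "?P = S"
      by (rule transitive[OF P]) (use t eq a_a b_b b_closed in auto)
    moreover have "sum (orbit_weight a b) ?P = 12"
      using t abt eq \<open>a (b t) \<noteq> t\<close> a_a b_b b_closed by (auto simp: orbit_weight_def)
    ultimately show "sum (orbit_weight a b) S = 12" by simp
  qed
  moreover have "b (a (b t)) = a (b t) \<longleftrightarrow> (\<forall>s\<in>S. a (b (a s)) = b (a (b s)))"
  proof
    assume eq: "b (a (b t)) = a (b t)"
    have "?P = S"
      by (rule transitive[OF P]) (use t eq a_a b_b b_closed in auto)
    moreover have "\<forall>s\<in>?P. a (b (a s)) = b (a (b s))"
      using t eq a_a b_b b_closed by auto
    ultimately show "\<forall>s\<in>S. a (b (a s)) = b (a (b s))" by simp
  next
    assume "\<forall>s\<in>S. a (b (a s)) = b (a (b s))"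
    then show "b (a (b t)) = a (b t)" using t by metis
  qed
  ultimately show ?thesis by linarith
qed

text \<open>
  Without fixed points, \<open>a\<close> and \<open>b\<close> commute nowhere, which makes the six points \<open>t\<close>, \<open>a t\<close>,
  \<open>b t\<close>, \<open>a (b t)\<close>, \<open>b (a t)\<close>, \<open>a (b (a t))\<close> distinct. They exhaust the cycle exactly if
  the walk closes up, that is, if \<open>b (a (b t)) = a (b (a t))\<close>.
\<close>

lemma cycle_orbit:
  assumes free: "\<And>t. t \<in> S \<Longrightarrow> a t \<noteq> t \<and> b t \<noteq> t"
  shows "sum (orbit_weight a b) S \<ge> 12 \<and>
    (sum (orbit_weight a b) S = 12 \<longleftrightarrow> (\<forall>s\<in>S. a (b (a s)) = b (a (b s))))"
proof -
  have "{t \<in> S. a t = t} = {}" "{t \<in> S. b t = t} = {}" "{t \<in> S. a t = t \<and> b t = t} = {}"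
    using free by blast+
  then have weight: "sum (orbit_weight a b) S = 2 * card S"
    using sum_orbit_weight[OF finite, of a b] by (simp only: card.empty)
  let ?P = "\<lambda>t. {t, a t, b t, a (b t), b (a t), a (b (a t))}"
  have P: "?P t \<subseteq> S" if "t \<in> S" for t
    using that a_closed b_closed by blast
  have inj_a: "a s = a t \<longleftrightarrow> s = t" if "s \<in> S" "t \<in> S" for s t
    using that by (intro inj_on_eq_iff[of a S] inj_on_inverseI[of S a a] a_a)
  have inj_b: "b s = b t \<longleftrightarrow> s = t" if "s \<in> S" "t \<in> S" for s t
    using that by (intro inj_on_eq_iff[of b S] inj_on_inverseI[of S b b] b_b)
  \<comment> \<open>These equivalences reduce every coincidence among the six points to \<open>free\<close>, \<open>ab\<close> or \<open>comm\<close>.\<close>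
  have flip_a: "a s = t \<longleftrightarrow> s = a t" if "s \<in> S" "t \<in> S" for s t
    using inj_a[OF that(1) a_closed[OF that(2)]] by (simp only: a_a[OF that(2)])
  have flip_b: "b s = t \<longleftrightarrow> s = b t" if "s \<in> S" "t \<in> S" for s t
    using inj_b[OF that(1) b_closed[OF that(2)]] by (simp only: b_b[OF that(2)])
  have comm: "a (b t) \<noteq> b (a t)" if "t \<in> S" for t
    using rigid free that by blast
  have ab: "a t \<noteq> b t" if "t \<in> S" for t
  proof
    assume "a t = b t"
    then have "a (b t) = t" "b (a t) = t" using that a_a[of t] b_b[of t] by simp_all
    then show False using comm[OF that] by simp
  qed
  have card_P: "card (?P t) = 6" if t: "t \<in> S" for t
  proof -
    note cl = t a_closed[OF t] b_closed[OF t] b_closed[OF a_closed[OF t]]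
    have "a (b t) \<noteq> t" "a (b t) \<noteq> a t" "b (a t) \<noteq> t" "b (a t) \<noteq> b t"
      "a (b (a t)) \<noteq> t" "a (b (a t)) \<noteq> a t" "a (b (a t)) \<noteq> b t" "a (b (a t)) \<noteq> a (b t)"
      using flip_a[OF cl(3,1)] inj_a[OF cl(3,1)] flip_b[OF cl(2,1)] inj_b[OF cl(2,1)]
        flip_a[OF cl(4,1)] inj_a[OF cl(4,1)] flip_a[OF cl(4,3)] inj_a[OF cl(4,3)]
        free[OF t] free[OF cl(2)] ab[OF t] comm[OF t] by metis+
    then have "distinct [t, a t, b t, a (b t), b (a t), a (b (a t))]"
      using free[OF cl(1)] free[OF cl(2)] free[OF cl(3)] free[OF cl(4)] ab[OF t] comm[OF t]
      by (simp add: not_sym)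
    from distinct_card[OF this] show ?thesis by simp
  qed
  obtain t0 where t0: "t0 \<in> S" using nonempty by blast
  have "card S \<ge> 6" using card_mono[OF finite P[OF t0]] card_P[OF t0] by simp
  moreover have "card S = 6 \<longleftrightarrow> (\<forall>s\<in>S. a (b (a s)) = b (a (b s)))"
  proof
    assume "card S = 6"
    show "\<forall>s\<in>S. a (b (a s)) = b (a (b s))"
    proof
      fix t assume t: "t \<in> S"
      then have S: "S = ?P t"
        using card_subset_eq[OF finite P[OF t]] card_P[OF t] \<open>card S = 6\<close> by simp
      note cl = t a_closed[OF t] b_closed[OF t] a_closed[OF b_closed[OF t]]
      have "b (a (b t)) \<in> S" using cl(4) by (rule b_closed)
      moreover have "b (a (b t)) \<noteq> t" "b (a (b t)) \<noteq> a t" "b (a (b t)) \<noteq> b t"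
        "b (a (b t)) \<noteq> a (b t)" "b (a (b t)) \<noteq> b (a t)"
        using flip_b[OF cl(4,1)] flip_b[OF cl(4,2)] inj_b[OF cl(4,1)] inj_b[OF cl(4,2)]
          flip_a[OF cl(3,1)] inj_a[OF cl(3,1)] free[OF cl(1)] free[OF cl(3)] free[OF cl(4)]
          comm[OF t] ab[OF t] by metis+
      moreover have "b (a (b t)) \<in> ?P t" using equalityD1[OF S] calculation(1) by (rule subsetD)
      ultimately show "a (b (a t)) = b (a (b t))" by simp
    qed
  next
    assume braid: "\<forall>s\<in>S. a (b (a s)) = b (a (b s))"
    have "?P t0 = S"
    proof (rule transitive[OF P[OF t0]])
      have "b (a (b (a t0))) = a (b t0)" "b (a (b t0)) = a (b (a t0))"
        using braid[rule_format, OF t0] braid[rule_format, OF a_closed[OF t0]] a_a[OF t0] by simp_all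
      moreover have "a (a t0) = t0" "b (b t0) = t0" "a (a (b t0)) = b t0" "b (b (a t0)) = a t0"
        "a (a (b (a t0))) = b (a t0)"
        using t0 a_closed b_closed a_a b_b by blast+
      ultimately have "\<forall>t\<in>?P t0. a t \<in> ?P t0 \<and> b t \<in> ?P t0" by simp
      then show "a t \<in> ?P t0 \<and> b t \<in> ?P t0" if "t \<in> ?P t0" for t
        using that by blast
    qed simp
    then show "card S = 6" using card_P[OF t0] by simp
  qed
  ultimately show ?thesis using weight by auto
qed

lemma orbit_weight_ge_and_eq_iff_braid:
  "sum (orbit_weight a b) S \<ge> 12 \<and>
    (sum (orbit_weight a b) S = 12 \<longleftrightarrow> (\<forall>s\<in>S. a (b (a s)) = b (a (b s))))"
proof (cases "\<exists>t\<in>S. a t = t \<or> b t = t")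
  case True
  then obtain t where t: "t \<in> S" "a t = t \<or> b t = t" by blast
  interpret swapped: rigid_orbit S b a by (rule swapped_orbit)
  have "orbit_weight b a = orbit_weight a b"
    by (auto simp: orbit_weight_def fun_eq_iff)
  consider "a t = t" "b t = t" | "a t = t" "b t \<noteq> t" | "b t = t" "a t \<noteq> t"
    using t by blast
  then show ?thesis
  proof cases
    case 1
    then show ?thesis using common_fixpoint[OF t(1)] by simp
  next
    case 2
    then show ?thesis using path_orbit[OF t(1)] by simp
  next
    case 3
    then have "sum (orbit_weight b a) S \<ge> 12 \<and>
      (sum (orbit_weight b a) S = 12 \<longleftrightarrow> (\<forall>s\<in>S. b (a (b s)) = a (b (a s))))"
      by (intro swapped.path_orbit[OF t(1)])
    then show ?thesis unfolding \<open>orbit_weight b a = orbit_weight a b\<close> by (metis (no_types))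
  qed
next
  case False
  then show ?thesis using cycle_orbit by blast
qed

end

section \<open>Counting the orbits\<close>

definition orbit_relation :: "'a set \<Rightarrow> ('a \<Rightarrow> 'a) \<Rightarrow> ('a \<Rightarrow> 'a) \<Rightarrow> ('a \<times> 'a) set" where
  "orbit_relation S a b = {(s, t). s \<in> S \<and> t \<in> S \<and> (\<lambda>s t. t = a s \<or> t = b s)\<^sup>*\<^sup>* s t}"

context rigid_involutions
begin

lemma reachable_closed:
  assumes "(\<lambda>s t. t = a s \<or> t = b s)\<^sup>*\<^sup>* s t" "Q \<subseteq> S" "s \<in> Q" "\<And>t. t \<in> Q \<Longrightarrow> a t \<in> Q \<and> b t \<in> Q"
  shows "t \<in> Q"
  using assms by (induction rule: rtranclp_induct) auto

lemma reachable_sym: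
  assumes "(\<lambda>s t. t = a s \<or> t = b s)\<^sup>*\<^sup>* s t" "s \<in> S"
  shows "(\<lambda>s t. t = a s \<or> t = b s)\<^sup>*\<^sup>* t s"
  using assms
proof (induction rule: rtranclp_induct)
  case (step t u)
  then have "t \<in> S" using reachable_closed[of s t S] a_closed b_closed by blast
  then have "t = a u \<or> t = b u" using step.hyps(2) a_a b_b by auto
  then show ?case using step.IH step.prems by (auto intro: converse_rtranclp_into_rtranclp)
qed simp

lemma equiv_orbit_relation: "equiv S (orbit_relation S a b)"
proof (rule equivI)
  show "sym (orbit_relation S a b)"
    using reachable_sym by (fastforce simp: orbit_relation_def intro: symI)
qed (auto simp: orbit_relation_def refl_on_def trans_def)

lemma rigid_orbit_quotient:
  assumes "P \<in> S // orbit_relation S a b"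
  shows "rigid_orbit P a b"
proof -
  from assms obtain s where s: "s \<in> S" and P: "P = orbit_relation S a b `` {s}"
    by (auto elim: quotientE)
  have sub: "P \<subseteq> S" by (auto simp: P orbit_relation_def)
  have mem: "t \<in> P \<longleftrightarrow> (\<lambda>s t. t = a s \<or> t = b s)\<^sup>*\<^sup>* s t" for t
    using s reachable_closed[of s t S] a_closed b_closed by (auto simp: P orbit_relation_def)
  show ?thesis
  proof
    show "finite P" using sub finite finite_subset by blast
    show "a t \<in> P" "b t \<in> P" if "t \<in> P" for t
      using rtranclp.rtrancl_into_rtrancl[OF iffD1[OF mem that]] by (simp_all add: mem)
    show "P \<noteq> {}" using mem by blast
    show "Q = P" if Q: "Q \<subseteq> P" "Q \<noteq> {}" "\<And>t. t \<in> Q \<Longrightarrow> a t \<in> Q \<and> b t \<in> Q" for Q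
    proof -
      obtain q where q: "q \<in> Q" using Q by blast
      have "t \<in> Q" if "t \<in> P" for t
      proof (rule reachable_closed[of q t Q])
        have "(\<lambda>s t. t = a s \<or> t = b s)\<^sup>*\<^sup>* q s"
          using reachable_sym[OF iffD1[OF mem subsetD[OF Q(1) q]] s] .
        then show "(\<lambda>s t. t = a s \<or> t = b s)\<^sup>*\<^sup>* q t"
          using rtranclp_trans iffD1[OF mem that] by fast
      qed (use q Q sub in auto)
      then show ?thesis using Q(1) by blast
    qed
  qed (use sub a_a b_b rigid in auto)
qed

text \<open>
  Summing the weights orbit by orbit, the total is at least 12 times the number of orbits. A sum of
  terms that are each at least 12 equals that bound only if every term does.
\<close>

theorem card_orbits_eq_iff_braid:
  "12 * card (S // orbit_relation S a b) =
     2 * card S + 3 * card {t \<in> S. a t = t} + 3 * card {t \<in> S. b t = t}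
     + 4 * card {t \<in> S. a t = t \<and> b t = t}
   \<longleftrightarrow> (\<forall>t\<in>S. a (b (a t)) = b (a (b t)))"
proof -
  let ?Q = "S // orbit_relation S a b" and ?w = "sum (orbit_weight a b)"
  note equiv = equiv_orbit_relation
  have fin_Q: "finite ?Q" using finite_quotient[OF finite equiv_type[OF equiv]] .
  have "?w S = ?w (\<Union>?Q)" by (simp add: Union_quotient[OF equiv])
  also have "\<dots> = sum ?w ?Q"
    using finite_equiv_class[OF finite equiv_type[OF equiv]] quotient_disj[OF equiv]
    by (subst sum.Union_disjoint) auto
  finally have total: "?w S = sum ?w ?Q" .
  have orbit: "?w P \<ge> 12 \<and> (?w P = 12 \<longleftrightarrow> (\<forall>s\<in>P. a (b (a s)) = b (a (b s))))" if "P \<in> ?Q" for P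
    using rigid_orbit.orbit_weight_ge_and_eq_iff_braid[OF rigid_orbit_quotient[OF that]] .
  have "sum ?w ?Q = sum (\<lambda>_. 12) ?Q \<longleftrightarrow> (\<forall>P\<in>?Q. ?w P = 12)"
  proof
    assume "sum ?w ?Q = sum (\<lambda>_. 12) ?Q"
    then show "\<forall>P\<in>?Q. ?w P = 12"
      using sum_mono_inv[of "\<lambda>_. 12" ?Q ?w] orbit fin_Q by force
  qed simp
  also have "\<dots> \<longleftrightarrow> (\<forall>P\<in>?Q. \<forall>s\<in>P. a (b (a s)) = b (a (b s)))"
    using orbit by blast
  also have "\<dots> \<longleftrightarrow> (\<forall>s\<in>\<Union>?Q. a (b (a s)) = b (a (b s)))" by blast
  finally show ?thesis
    using total sum_orbit_weight[OF finite, of a b] by (auto simp: Union_quotient[OF equiv])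
qed

end

section \<open>Words and functionals on the free algebra\<close>

definition words :: "'x set \<Rightarrow> nat \<Rightarrow> 'x list set" where
  "words X d = {w \<in> lists X. length w = d}"

definition word_step ::
  "'x set \<Rightarrow> ('x \<times> 'x \<Rightarrow> 'x \<times> 'x) \<Rightarrow> 'x list \<Rightarrow> 'x list \<Rightarrow> bool" where
  "word_step X r v w \<longleftrightarrow> (\<exists>p q x y y' x'. p \<in> lists X \<and> q \<in> lists X \<and> x \<in> X \<and> y \<in> X \<and>
     r (x, y) = (y', x') \<and> v = p @ [x, y] @ q \<and> w = p @ [y', x'] @ q)"

lemma word_stepI:
  assumes "p \<in> lists X" "q \<in> lists X" "x \<in> X" "y \<in> X" "r (x, y) = (y', x')"
  shows "word_step X r (p @ [x, y] @ q) (p @ [y', x'] @ q)"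
  unfolding word_step_def using assms by blast

lemma word_stepE:
  assumes "word_step X r v w"
  obtains p q x y y' x' where "p \<in> lists X" "q \<in> lists X" "x \<in> X" "y \<in> X"
    "r (x, y) = (y', x')" "v = p @ [x, y] @ q" "w = p @ [y', x'] @ q"
  using assms unfolding word_step_def by blast

lemma word_step_append:
  assumes "word_step X r v w" "s \<in> lists X" "t \<in> lists X"
  shows "word_step X r (s @ v @ t) (s @ w @ t)"
  using assms(1)
proof (cases rule: word_stepE)
  case (1 p q x y y' x')
  then show ?thesis
    using word_stepI[of "s @ p" X "q @ t" x y r y' x'] assms(2,3) by simp
qed

definition word_relation ::
  "'x set \<Rightarrow> ('x \<times> 'x \<Rightarrow> 'x \<times> 'x) \<Rightarrow> nat \<Rightarrow> ('x list \<times> 'x list) set" where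
  "word_relation X r d = {(v, w). v \<in> words X d \<and> w \<in> words X d \<and> (word_step X r)\<^sup>*\<^sup>* v w}"

text \<open>
  Functions on words are the linear functionals on the free algebra.
\<close>

definition pairing :: "('x word \<Rightarrow>\<^sub>0 'k::field) \<Rightarrow> ('x list \<Rightarrow> 'k) \<Rightarrow> 'k" where
  "pairing f h = (\<Sum>w\<in>Poly_Mapping.keys f. Poly_Mapping.lookup f w * h (letters w))"

definition class_function ::
  "'x set \<Rightarrow> ('x \<times> 'x \<Rightarrow> 'x \<times> 'x) \<Rightarrow> ('x list \<Rightarrow> 'k) \<Rightarrow> bool" where
  "class_function X r h \<longleftrightarrow> (\<forall>v w. word_step X r v w \<longrightarrow> h v = h w)"

text \<open>
  Vanishing under all class functions, in every degree at once, is what makes this set an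
  ideal; the degree-\<open>d\<close> class functions alone would not do.
\<close>

definition annihilator ::
  "'x set \<Rightarrow> ('x \<times> 'x \<Rightarrow> 'x \<times> 'x) \<Rightarrow> ('x word \<Rightarrow>\<^sub>0 'k::field) set" where
  "annihilator X r =
     {f \<in> carrier (free_algebra X). \<forall>h. class_function X r h \<longrightarrow> pairing f h = 0}"

lemma poly_mapping_eq_sum_single:
  "f = (\<Sum>w\<in>Poly_Mapping.keys f. Poly_Mapping.single w (Poly_Mapping.lookup f w))"
proof (rule poly_mapping_eqI)
  fix v
  have "(\<Sum>w\<in>Poly_Mapping.keys f. Poly_Mapping.lookup (Poly_Mapping.single w (Poly_Mapping.lookup f w)) v) =
      (\<Sum>w\<in>Poly_Mapping.keys f. if v = w then Poly_Mapping.lookup f w else 0)"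
    by (rule sum.cong) (auto simp: lookup_single when_def)
  then show "Poly_Mapping.lookup f v = Poly_Mapping.lookup (\<Sum>w\<in>Poly_Mapping.keys f. Poly_Mapping.single w (Poly_Mapping.lookup f w)) v"
    by (simp add: lookup_sum in_keys_iff)
qed

lemma pairing_superset:
  assumes "finite A" "Poly_Mapping.keys f \<subseteq> A"
  shows "pairing f h = (\<Sum>w\<in>A. Poly_Mapping.lookup f w * h (letters w))"
  unfolding pairing_def using assms by (intro sum.mono_neutral_left) (auto simp: in_keys_iff)

lemma pairing_zero [simp]: "pairing 0 h = 0"
  by (simp add: pairing_def)

lemma pairing_single [simp]: "pairing (Poly_Mapping.single w c) h = c * h (letters w)"
  by (subst pairing_superset[of "{w}"]) auto

lemma pairing_monomial [simp]: "pairing (monomial w) h = h w"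
  by (simp add: monomial_def)

lemma pairing_add: "pairing (f + g) h = pairing f h + pairing g h"
proof -
  let ?A = "Poly_Mapping.keys f \<union> Poly_Mapping.keys g"
  have "pairing p h = (\<Sum>w\<in>?A. Poly_Mapping.lookup p w * h (letters w))" if "p \<in> {f, g, f + g}" for p
    using that by (intro pairing_superset) (auto dest: subsetD[OF Poly_Mapping.keys_add])
  then show ?thesis by (simp add: lookup_add distrib_right sum.distrib)
qed

lemma pairing_uminus: "pairing (- f) h = - pairing f h"
  by (simp add: pairing_def sum_negf)

lemma pairing_diff: "pairing (f - g) h = pairing f h - pairing g h"
  using pairing_add[of f "- g" h] by (simp add: pairing_uminus)

lemma pairing_sum: "pairing (sum f A) h = (\<Sum>i\<in>A. pairing (f i) h)"
  by (induction A rule: infinite_finite_induct) (auto simp: pairing_add)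

text \<open>
  Multiplication by a fixed factor is transposed to a translation of the functional. This
  identity reduces the ideal property of the annihilator to the stability of class functions
  under translation.
\<close>

lemma pairing_mult: "pairing (f * g) h = pairing f (\<lambda>u. pairing g (\<lambda>v. h (u @ v)))"
proof -
  have "f * g = (\<Sum>u\<in>Poly_Mapping.keys f. Poly_Mapping.single u (Poly_Mapping.lookup f u)) *
     (\<Sum>v\<in>Poly_Mapping.keys g. Poly_Mapping.single v (Poly_Mapping.lookup g v))"
    using poly_mapping_eq_sum_single[of f] poly_mapping_eq_sum_single[of g] by simp
  also have "\<dots> = (\<Sum>u\<in>Poly_Mapping.keys f. \<Sum>v\<in>Poly_Mapping.keys g.
      Poly_Mapping.single (u + v) (Poly_Mapping.lookup f u * Poly_Mapping.lookup g v))"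
    by (simp add: sum_product mult_single)
  finally show ?thesis
    by (simp add: pairing_sum plus_word_def pairing_def[of f] pairing_def[of g]
        sum_distrib_left mult.assoc)
qed

lemma pairing_cong:
  assumes "\<And>w. w \<in> Poly_Mapping.keys f \<Longrightarrow> h (letters w) = h' (letters w)"
  shows "pairing f h = pairing f h'"
  unfolding pairing_def using assms by simp

lemma mem_free_algebra_iff:
  "f \<in> carrier (free_algebra X) \<longleftrightarrow> (\<forall>w\<in>Poly_Mapping.keys f. letters w \<in> lists X)"
  by (simp add: free_algebra_def)

lemma free_algebra_simps:
  "f \<otimes>\<^bsub>free_algebra X\<^esub> g = f * g" "f \<oplus>\<^bsub>free_algebra X\<^esub> g = f + g"
  "\<one>\<^bsub>free_algebra X\<^esub> = 1" "\<zero>\<^bsub>free_algebra X\<^esub> = 0"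
  by (simp_all add: free_algebra_def)

lemma single_mem_free_algebra: "letters w \<in> lists X \<Longrightarrow> Poly_Mapping.single w c \<in> carrier (free_algebra X)"
  by (auto simp: mem_free_algebra_iff)

lemma monomial_mem_free_algebra: "w \<in> lists X \<Longrightarrow> monomial w \<in> carrier (free_algebra X)"
  by (simp add: monomial_def single_mem_free_algebra)

lemma supported_mem_free_algebra:
  assumes "Poly_Mapping.keys f \<subseteq> Word ` A" "A \<subseteq> lists X"
  shows "f \<in> carrier (free_algebra X)"
  unfolding mem_free_algebra_iff
proof
  fix w assume "w \<in> Poly_Mapping.keys f"
  then obtain t where "w = Word t" "t \<in> A" using assms(1) by blast
  then show "letters w \<in> lists X" using assms(2) by auto
qed

lemma uminus_mem_free_algebra: "f \<in> carrier (free_algebra X) \<Longrightarrow> - f \<in> carrier (free_algebra X)"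
  by (simp add: mem_free_algebra_iff)

lemma add_mem_free_algebra:
  "f \<in> carrier (free_algebra X) \<Longrightarrow> g \<in> carrier (free_algebra X) \<Longrightarrow> f + g \<in> carrier (free_algebra X)"
  using ring.ring_simprules(1)[OF ring_free_algebra] by (simp add: free_algebra_simps)

lemma diff_mem_free_algebra:
  "f \<in> carrier (free_algebra X) \<Longrightarrow> g \<in> carrier (free_algebra X) \<Longrightarrow> f - g \<in> carrier (free_algebra X)"
  using add_mem_free_algebra[OF _ uminus_mem_free_algebra, of f X g] by simp

lemma a_inv_free_algebra:
  assumes "f \<in> carrier (free_algebra X)"
  shows "\<ominus>\<^bsub>free_algebra X\<^esub> f = - f"
proof -
  interpret F: ring "free_algebra X" by (rule ring_free_algebra)
  show ?thesis
    using assms uminus_mem_free_algebra[OF assms]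
    by (intro F.minus_equality) (simp_all add: free_algebra_simps)
qed

lemma a_minus_free_algebra:
  assumes "g \<in> carrier (free_algebra X)"
  shows "f \<ominus>\<^bsub>free_algebra X\<^esub> g = f - g"
  using assms by (simp add: a_minus_def a_inv_free_algebra free_algebra_simps)

lemma ideal_free_algebraI:
  assumes "J \<subseteq> carrier (free_algebra X)" "0 \<in> J" "\<And>f g. f \<in> J \<Longrightarrow> g \<in> J \<Longrightarrow> f - g \<in> J"
    and "\<And>f g. f \<in> J \<Longrightarrow> g \<in> carrier (free_algebra X) \<Longrightarrow> g * f \<in> J \<and> f * g \<in> J"
  shows "ideal J (free_algebra X)"
proof (rule idealI)
  interpret F: ring "free_algebra X" by (rule ring_free_algebra)
  have neg: "- f \<in> J" if "f \<in> J" for f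
    using assms(3)[OF assms(2) that] by simp
  show "subgroup J (add_monoid (free_algebra X))"
  proof (rule F.add.subgroupI)
    show "\<ominus>\<^bsub>free_algebra X\<^esub> f \<in> J" if "f \<in> J" for f
      using a_inv_free_algebra[OF subsetD[OF assms(1) that]] neg[OF that] by simp
    show "f \<oplus>\<^bsub>free_algebra X\<^esub> g \<in> J" if "f \<in> J" "g \<in> J" for f g
      using assms(3)[OF that(1) neg[OF that(2)]] by (simp add: free_algebra_simps)
  qed (use assms in auto)
qed (use assms ring_free_algebra in \<open>auto simp: free_algebra_simps\<close>)

text \<open>
  If \<open>h\<close> is a class function, then so are \<open>v \<mapsto> h (u v)\<close> and \<open>u \<mapsto> h (u v)\<close>, since rewriting
  is compatible with concatenation.
\<close>

lemma ideal_annihilator: "ideal (annihilator X r :: ('x word \<Rightarrow>\<^sub>0 'k::field) set) (free_algebra X)"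
proof (rule ideal_free_algebraI)
  fix f g :: "'x word \<Rightarrow>\<^sub>0 'k"
  assume f: "f \<in> annihilator X r" and g: "g \<in> carrier (free_algebra X)"
  then have carr: "f \<in> carrier (free_algebra X)" by (simp add: annihilator_def)
  have mult: "g * f \<in> carrier (free_algebra X)" "f * g \<in> carrier (free_algebra X)"
    using ring.ring_simprules(5)[OF ring_free_algebra] carr g by (simp_all add: free_algebra_simps)
  have append_left: "word_step X r (u @ v) (u @ w)" if "word_step X r v w" "u \<in> lists X" for u v w
    using word_step_append[OF that, of "[]"] by simp
  have append_right: "word_step X r (v @ u) (w @ u)" if "word_step X r v w" "u \<in> lists X" for u v w
    using word_step_append[OF that(1) _ that(2), of "[]"] by simp
  have "pairing (g * f) h = 0 \<and> pairing (f * g) h = 0" if h: "class_function X r h" for h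
  proof
    have "pairing (g * f) h = pairing g (\<lambda>_. 0)"
      unfolding pairing_mult
    proof (rule pairing_cong)
      fix u assume "u \<in> Poly_Mapping.keys g"
      then have "class_function X r (\<lambda>v. h (letters u @ v))"
        using h g append_left by (auto simp: class_function_def mem_free_algebra_iff)
      then show "pairing f (\<lambda>v. h (letters u @ v)) = 0"
        using f by (simp add: annihilator_def)
    qed
    then show "pairing (g * f) h = 0" by (simp add: pairing_def)
    have "class_function X r (\<lambda>u. pairing g (\<lambda>v. h (u @ v)))"
      unfolding class_function_def
    proof (intro allI impI pairing_cong)
      fix v w u assume "word_step X r v w" "u \<in> Poly_Mapping.keys g"
      then show "h (v @ letters u) = h (w @ letters u)"
        using h g append_right by (auto simp: class_function_def mem_free_algebra_iff)
    qed
    then show "pairing (f * g) h = 0"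
      unfolding pairing_mult using f by (simp add: annihilator_def)
  qed
  then show "g * f \<in> annihilator X r \<and> f * g \<in> annihilator X r"
    using mult by (simp add: annihilator_def)
qed (auto simp: annihilator_def pairing_diff diff_mem_free_algebra mem_free_algebra_iff[of 0])

section \<open>The relation ideal\<close>

locale involutive_quadratic_set =
  fixes X :: "'x set" and r :: "'x \<times> 'x \<Rightarrow> 'x \<times> 'x"
  assumes r_closed: "\<And>x y y' x'. x \<in> X \<Longrightarrow> y \<in> X \<Longrightarrow> r (x, y) = (y', x') \<Longrightarrow> y' \<in> X \<and> x' \<in> X"
    and r_r: "\<And>x y. x \<in> X \<Longrightarrow> y \<in> X \<Longrightarrow> r (r (x, y)) = (x, y)"
begin

lemma word_step_sym: "word_step X r v w \<Longrightarrow> word_step X r w v"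
  using r_closed r_r by (elim word_stepE) (metis word_stepI)

text \<open>
  As \<open>r\<close> is an involution, rewriting steps can be undone, and the reflexive transitive closure is
  already an equivalence relation.
\<close>

lemma word_steps_sym: "(word_step X r)\<^sup>*\<^sup>* v w \<Longrightarrow> (word_step X r)\<^sup>*\<^sup>* w v"
  by (induction rule: rtranclp_induct) (auto intro: converse_rtranclp_into_rtranclp word_step_sym)

lemma equiv_word_relation: "equiv (words X d) (word_relation X r d)"
proof (rule equivI)
  show "sym (word_relation X r d)"
    by (rule symI) (auto simp: word_relation_def intro: word_steps_sym)
qed (auto simp: word_relation_def refl_on_def trans_def)

text \<open>
  The indicator functions of classes are the functionals that separate different classes.
\<close>

lemma class_function_reachable: "class_function X r (\<lambda>w. of_bool ((word_step X r)\<^sup>*\<^sup>* t w))"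
  unfolding class_function_def
proof (intro allI impI)
  fix v w assume step: "word_step X r v w"
  have "(word_step X r)\<^sup>*\<^sup>* t v \<longleftrightarrow> (word_step X r)\<^sup>*\<^sup>* t w"
    using rtranclp.rtrancl_into_rtrancl[of "word_step X r" t v w]
      rtranclp.rtrancl_into_rtrancl[of "word_step X r" t w v] step word_step_sym[OF step] by blast
  then show "of_bool ((word_step X r)\<^sup>*\<^sup>* t v) = of_bool ((word_step X r)\<^sup>*\<^sup>* t w)" by simp
qed

lemma quadratic_relations_subset:
  "quadratic_relations X r \<subseteq> carrier (free_algebra X)"
proof -
  have "monomial [x, y] - monomial [y', x'] \<in> carrier (free_algebra X)"
    if "x \<in> X" "y \<in> X" "r (x, y) = (y', x')" for x y y' x'
    using that r_closed[OF that] by (intro diff_mem_free_algebra monomial_mem_free_algebra) auto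
  then show ?thesis unfolding quadratic_relations_def by blast
qed

lemma ideal_relation_ideal: "ideal (relation_ideal X r) (free_algebra X)"
  unfolding relation_ideal_def
  by (rule ring.genideal_ideal[OF ring_free_algebra quadratic_relations_subset])

text \<open>
  The upper bound on the relation ideal: it contains no element that some class function detects.
\<close>

lemma relation_ideal_subset_annihilator: "relation_ideal X r \<subseteq> annihilator X r"
  unfolding relation_ideal_def
proof (rule ring.genideal_minimal[OF ring_free_algebra ideal_annihilator])
  show "quadratic_relations X r \<subseteq> annihilator X r"
  proof
    fix f assume f: "f \<in> quadratic_relations X r"
    then obtain x y y' x' where xy: "x \<in> X" "y \<in> X" "r (x, y) = (y', x')"
      and f_eq: "f = monomial [x, y] - monomial [y', x']"
      unfolding quadratic_relations_def by blast
    have "word_step X r [x, y] [y', x']"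
      using word_stepI[of "[]" X "[]" x y r y' x'] xy by simp
    then have "pairing f h = 0" if "class_function X r h" for h
      using that by (simp add: f_eq pairing_diff class_function_def)
    then show "f \<in> annihilator X r"
      using f quadratic_relations_subset by (auto simp: annihilator_def)
  qed
qed

lemma pairing_relation_ideal:
  "f \<in> relation_ideal X r \<Longrightarrow> class_function X r h \<Longrightarrow> pairing f h = 0"
  using relation_ideal_subset_annihilator by (auto simp: annihilator_def)

lemma relation_ideal_closed:
  "0 \<in> relation_ideal X r"
  "f \<in> relation_ideal X r \<Longrightarrow> g \<in> relation_ideal X r \<Longrightarrow> f + g \<in> relation_ideal X r"
  "f \<in> relation_ideal X r \<Longrightarrow> g \<in> carrier (free_algebra X) \<Longrightarrow> g * f \<in> relation_ideal X r"
  "f \<in> relation_ideal X r \<Longrightarrow> g \<in> carrier (free_algebra X) \<Longrightarrow> f * g \<in> relation_ideal X r"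
proof -
  note subgroup = ideal.axioms(1)[OF ideal_relation_ideal]
  show "0 \<in> relation_ideal X r"
    "f \<in> relation_ideal X r \<Longrightarrow> g \<in> relation_ideal X r \<Longrightarrow> f + g \<in> relation_ideal X r"
    "f \<in> relation_ideal X r \<Longrightarrow> g \<in> carrier (free_algebra X) \<Longrightarrow> g * f \<in> relation_ideal X r"
    "f \<in> relation_ideal X r \<Longrightarrow> g \<in> carrier (free_algebra X) \<Longrightarrow> f * g \<in> relation_ideal X r"
    using additive_subgroup.zero_closed[OF subgroup] additive_subgroup.a_closed[OF subgroup]
      ideal.I_l_closed[OF ideal_relation_ideal] ideal.I_r_closed[OF ideal_relation_ideal]
    by (simp_all add: free_algebra_simps)
qed

lemma relation_ideal_sum:
  "(\<And>i. i \<in> A \<Longrightarrow> f i \<in> relation_ideal X r) \<Longrightarrow> sum f A \<in> relation_ideal X r"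
  by (induction A rule: infinite_finite_induct) (auto simp: relation_ideal_closed)

lemma residue_class_eq_iff:
  assumes "f \<in> carrier (free_algebra X)" "g \<in> carrier (free_algebra X)"
  shows "residue_class X r f = residue_class X r g \<longleftrightarrow> f - g \<in> relation_ideal X r"
  using ring.quotient_eq_iff_same_a_r_cos[OF ring_free_algebra ideal_relation_ideal assms]
  by (simp add: residue_class_def a_minus_free_algebra[OF assms(2)])

lemma monomial_append: "monomial (p @ q) = monomial p * monomial q"
  by (simp add: monomial_def mult_single plus_word_def)

lemma word_step_imp_diff_mem:
  assumes "word_step X r v w"
  shows "monomial v - monomial w \<in> relation_ideal X r"
proof -
  from assms obtain p q x y y' x' where pq: "p \<in> lists X" "q \<in> lists X"
    and xy: "x \<in> X" "y \<in> X" "r (x, y) = (y', x')"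
    and vw: "v = p @ [x, y] @ q" "w = p @ [y', x'] @ q"
    unfolding word_step_def by blast
  have "monomial [x, y] - monomial [y', x'] \<in> relation_ideal X r"
  proof (cases "(y', x') = (x, y)")
    case False
    then have "monomial [x, y] - monomial [y', x'] \<in> quadratic_relations X r"
      unfolding quadratic_relations_def using xy by blast
    then show ?thesis
      unfolding relation_ideal_def
      using ring.genideal_self[OF ring_free_algebra quadratic_relations_subset] by blast
  qed (simp add: relation_ideal_closed)
  then have "monomial p * (monomial [x, y] - monomial [y', x']) * monomial q \<in> relation_ideal X r"
    using pq by (intro relation_ideal_closed monomial_mem_free_algebra)
  then show ?thesis
    unfolding vw monomial_append by (simp add: algebra_simps)
qed

text \<open>
  The lower bound on the relation ideal: words of one class become equal in the quotient.
\<close>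

lemma word_steps_imp_diff_mem:
  assumes "(word_step X r)\<^sup>*\<^sup>* v w"
  shows "monomial v - monomial w \<in> relation_ideal X r"
  using assms
proof (induction rule: rtranclp_induct)
  case (step w u)
  show ?case
    using relation_ideal_closed(2)[OF step.IH word_step_imp_diff_mem[OF step.hyps(2)]] by simp
qed (simp add: relation_ideal_closed)

lemma ring_hom_residue_class:
  "ring_hom_ring (free_algebra X) (quadratic_algebra X r) (residue_class X r)"
  using ideal.rcos_ring_hom_ring[OF ideal_relation_ideal]
  unfolding quadratic_algebra_def residue_class_def .

section \<open>Scalars and bases of the graded components\<close>

lemma subfield_constants:
  "subfield (range (Poly_Mapping.single 0) :: ('x word \<Rightarrow>\<^sub>0 'k::field) set) (free_algebra X)"
proof -
  let ?F = "free_algebra X :: ('x word \<Rightarrow>\<^sub>0 'k) ring"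
  let ?K = "range (Poly_Mapping.single 0) :: ('x word \<Rightarrow>\<^sub>0 'k) set"
  interpret F: ring ?F by (rule ring_free_algebra)
  have carr: "?K \<subseteq> carrier ?F"
    by (auto intro!: single_mem_free_algebra simp: zero_word_def)
  show ?thesis
  proof (rule F.subfieldI)
    show "subcring ?K ?F"
    proof (rule F.subcringI, rule F.subringI[OF carr])
      show "\<one>\<^bsub>?F\<^esub> \<in> ?K" by (auto simp: free_algebra_simps simp flip: single_one)
      show "\<ominus>\<^bsub>?F\<^esub> h \<in> ?K" if "h \<in> ?K" for h
        using a_inv_free_algebra[OF subsetD[OF carr that]] that by (auto simp flip: single_uminus)
    qed (auto simp: free_algebra_simps mult_single mult.commute simp flip: single_add)
    show "Units (?F\<lparr>carrier := ?K\<rparr>) = ?K - {\<zero>\<^bsub>?F\<^esub>}"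
    proof (intro equalityI subsetI)
      fix h assume "h \<in> Units (?F\<lparr>carrier := ?K\<rparr>)"
      then show "h \<in> ?K - {\<zero>\<^bsub>?F\<^esub>}"
        by (auto simp: Units_def free_algebra_simps)
    next
      fix h assume "h \<in> ?K - {\<zero>\<^bsub>?F\<^esub>}"
      then obtain c where c: "h = Poly_Mapping.single 0 c" "c \<noteq> 0"
        by (auto simp: free_algebra_simps) (metis single_zero)
      then show "h \<in> Units (?F\<lparr>carrier := ?K\<rparr>)"
        by (auto simp: Units_def free_algebra_simps mult_single intro!: exI[of _ "inverse c"])
    qed
  qed
qed

text \<open>
  The quotient is not trivial because the indicator of the empty word is a class function: every
  rewriting step involves words of length at least two.
\<close>

lemma subfield_scalars:
  "subfield (scalars X r :: ('x word \<Rightarrow>\<^sub>0 'k::field) set set) (quadratic_algebra X r)"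
proof -
  let ?Q = "quadratic_algebra X r :: ('x word \<Rightarrow>\<^sub>0 'k) set ring"
  let ?res = "residue_class X r :: ('x word \<Rightarrow>\<^sub>0 'k) \<Rightarrow> _"
  interpret ring_hom_ring "free_algebra X" ?Q ?res by (rule ring_hom_residue_class)
  have "\<one>\<^bsub>?Q\<^esub> \<noteq> \<zero>\<^bsub>?Q\<^esub>"
  proof
    assume "\<one>\<^bsub>?Q\<^esub> = \<zero>\<^bsub>?Q\<^esub>"
    then have "?res 1 = ?res 0" using hom_one hom_zero by (simp add: free_algebra_simps)
    then have "1 \<in> (relation_ideal X r :: ('x word \<Rightarrow>\<^sub>0 'k) set)"
      using residue_class_eq_iff[OF R.one_closed R.zero_closed] by (simp add: free_algebra_simps)
    moreover have "class_function X r (\<lambda>w. of_bool (w = []) :: 'k)"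
      by (auto simp: class_function_def word_step_def)
    ultimately have "pairing (1 :: 'x word \<Rightarrow>\<^sub>0 'k) (\<lambda>w. of_bool (w = [])) = 0"
      by (rule pairing_relation_ideal)
    then show False
      by (simp add: zero_word_def flip: single_one)
  qed
  then have "subfield (?res ` range (Poly_Mapping.single 0)) ?Q"
    by (rule img_is_subfield(2)[OF subfield_constants])
  then show ?thesis by (simp add: scalars_def image_image)
qed

lemma Span_residue_monomials:
  assumes "set ts \<subseteq> lists X"
  shows "ring.Span (quadratic_algebra X r) (scalars X r) (map (\<lambda>t. residue_class X r (monomial t)) ts) =
    residue_class X r ` {f :: 'x word \<Rightarrow>\<^sub>0 'k::field. Poly_Mapping.keys f \<subseteq> Word ` set ts}"
  using assms
proof (induction ts)
  let ?Q = "quadratic_algebra X r :: ('x word \<Rightarrow>\<^sub>0 'k) set ring"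
  let ?res = "residue_class X r :: ('x word \<Rightarrow>\<^sub>0 'k) \<Rightarrow> _"
  interpret ring_hom_ring "free_algebra X" ?Q ?res by (rule ring_hom_residue_class)
  {
    case Nil
    have "{f :: 'x word \<Rightarrow>\<^sub>0 'k. Poly_Mapping.keys f \<subseteq> {}} = {0}"
      by auto
    then show ?case using hom_zero by (simp add: free_algebra_simps)
  next
    case (Cons t ts)
    let ?E = "\<lambda>ts. {f :: 'x word \<Rightarrow>\<^sub>0 'k. Poly_Mapping.keys f \<subseteq> Word ` set ts}"
    have E: "f \<in> carrier (free_algebra X)" if "f \<in> ?E ts" for f
      using that Cons.prems by (intro supported_mem_free_algebra[of f "set ts"]) auto
    have combine: "?res (Poly_Mapping.single 0 c) \<otimes>\<^bsub>?Q\<^esub> ?res (monomial t) \<oplus>\<^bsub>?Q\<^esub> ?res f =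
        ?res (Poly_Mapping.single (Word t) c + f)" if "f \<in> ?E ts" for c f
    proof -
      have "Poly_Mapping.single 0 c \<in> carrier (free_algebra X)" "monomial t \<in> carrier (free_algebra X)"
        using Cons.prems by (auto intro!: single_mem_free_algebra monomial_mem_free_algebra simp: zero_word_def)
      then have "?res (Poly_Mapping.single 0 c * monomial t + f) =
          ?res (Poly_Mapping.single 0 c) \<otimes>\<^bsub>?Q\<^esub> ?res (monomial t) \<oplus>\<^bsub>?Q\<^esub> ?res f"
        using hom_add[OF R.m_closed E[OF that]] hom_mult by (simp add: free_algebra_simps)
      then show ?thesis by (simp add: monomial_def mult_single)
    qed
    have "S.Span (scalars X r) (map (\<lambda>t. ?res (monomial t)) (t # ts)) =
        {?res (Poly_Mapping.single (Word t) c + f) | c f. f \<in> ?E ts}"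
      using Cons combine by (auto simp: S.line_extension_mem_iff scalars_def) blast+
    also have "{?res (Poly_Mapping.single (Word t) c + f) | c f. f \<in> ?E ts} =
        ?res ` {Poly_Mapping.single (Word t) c + f | c f. f \<in> ?E ts}" by blast
    also have "{Poly_Mapping.single (Word t) c + f | c f. f \<in> ?E ts} = ?E (t # ts)"
    proof (intro equalityI subsetI)
      fix g assume "g \<in> {Poly_Mapping.single (Word t) c + f | c f. f \<in> ?E ts}"
      then obtain c f where "g = Poly_Mapping.single (Word t) c + f" "f \<in> ?E ts" by blast
      then show "g \<in> ?E (t # ts)"
        using Poly_Mapping.keys_add[of "Poly_Mapping.single (Word t) c" f]
        by (auto split: if_splits)
    next
      fix g assume g: "g \<in> ?E (t # ts)"
      let ?f = "g - Poly_Mapping.single (Word t) (Poly_Mapping.lookup g (Word t))"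
      have "?f \<in> ?E ts"
        using g by (auto simp: in_keys_iff lookup_minus lookup_single when_def split: if_splits)
      moreover have "g = Poly_Mapping.single (Word t) (Poly_Mapping.lookup g (Word t)) + ?f" by simp
      ultimately show "g \<in> {Poly_Mapping.single (Word t) c + f | c f. f \<in> ?E ts}" by blast
    qed
    finally show ?case .
  }
qed

text \<open>
  Words of pairwise different classes stay independent: the indicator of the class of \<open>t\<close> is 1
  on \<open>t\<close> and vanishes on all combinations of the other words.
\<close>

lemma independent_residue_monomials:
  assumes "set ts \<subseteq> lists X" "distinct ts"
    and "\<And>s t. s \<in> set ts \<Longrightarrow> t \<in> set ts \<Longrightarrow> (word_step X r)\<^sup>*\<^sup>* s t \<Longrightarrow> s = t"
  shows "ring.independent (quadratic_algebra X r) (scalars X r)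
    (map (\<lambda>t. residue_class X r (monomial t :: 'x word \<Rightarrow>\<^sub>0 'k::field)) ts)"
  using assms
proof (induction ts)
  let ?Q = "quadratic_algebra X r :: ('x word \<Rightarrow>\<^sub>0 'k) set ring"
  let ?res = "residue_class X r :: ('x word \<Rightarrow>\<^sub>0 'k) \<Rightarrow> _"
  interpret ring_hom_ring "free_algebra X" ?Q ?res by (rule ring_hom_residue_class)
  {
    case Nil
    then show ?case by simp
  next
    case (Cons t ts)
    have t: "monomial t \<in> carrier (free_algebra X)"
      using Cons.prems by (auto intro: monomial_mem_free_algebra)
    have "?res (monomial t) \<notin> S.Span (scalars X r) (map (\<lambda>t. ?res (monomial t)) ts)"
    proof
      assume "?res (monomial t) \<in> S.Span (scalars X r) (map (\<lambda>t. ?res (monomial t)) ts)"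
      moreover have "set ts \<subseteq> lists X" using Cons.prems(1) by simp
      ultimately have "?res (monomial t) \<in> ?res ` {f. Poly_Mapping.keys f \<subseteq> Word ` set ts}"
        by (simp only: Span_residue_monomials)
      then obtain f :: "'x word \<Rightarrow>\<^sub>0 'k" where f: "Poly_Mapping.keys f \<subseteq> Word ` set ts"
        and eq: "?res (monomial t) = ?res f"
        by blast
      have "f \<in> carrier (free_algebra X)"
        using f Cons.prems(1) by (intro supported_mem_free_algebra[of f "set ts"]) auto
      with eq t have mem: "monomial t - f \<in> relation_ideal X r"
        using residue_class_eq_iff by blast
      let ?h = "\<lambda>w. of_bool ((word_step X r)\<^sup>*\<^sup>* t w) :: 'k"
      have "pairing f ?h = pairing f (\<lambda>_. 0)"
      proof (rule pairing_cong)
        fix w assume "w \<in> Poly_Mapping.keys f"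
        then have "letters w \<in> set ts" using f by auto
        then show "?h (letters w) = 0"
          using Cons.prems(2) Cons.prems(3)[of t "letters w"] by auto
      qed
      then have "pairing f ?h = 0" by (simp add: pairing_def)
      then show False
        using pairing_relation_ideal[OF mem class_function_reachable[of t]] by (simp add: pairing_diff)
    qed
    moreover have "S.independent (scalars X r) (map (\<lambda>t. ?res (monomial t)) ts)"
      using Cons by auto
    ultimately show ?case
      using hom_closed[OF t] by (auto intro: S.independent.li_Cons)
  }
qed

lemma finite_words: "finite X \<Longrightarrow> finite (words X d)"
  using finite_lists_length_eq[of X d] by (simp add: words_def in_lists_conv_set subset_eq conj_commute)

text \<open>
  One representative for each class gives a basis. A homogeneous element is brought into the
  span by replacing each of its words by the representative, which changes it by an element of
  the ideal.
\<close>

theorem dimension_graded_component: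
  assumes "finite X"
  shows "ring.dimension (quadratic_algebra X r :: ('x word \<Rightarrow>\<^sub>0 'k::field) set ring)
    (card (words X d // word_relation X r d)) (scalars X r) (graded_component X r d)"
proof -
  let ?Q = "quadratic_algebra X r :: ('x word \<Rightarrow>\<^sub>0 'k) set ring"
  let ?res = "residue_class X r :: ('x word \<Rightarrow>\<^sub>0 'k) \<Rightarrow> _"
  let ?W = "words X d" and ?R = "word_relation X r d"
  interpret ring_hom_ring "free_algebra X" ?Q ?res by (rule ring_hom_residue_class)
  note equiv = equiv_word_relation[of d]
  define rep where "rep w = (SOME v. v \<in> ?R `` {w})" for w
  have rep: "(w, rep w) \<in> ?R" if "w \<in> ?W" for w
    using someI[of "\<lambda>v. v \<in> ?R `` {w}" w] equiv_class_self[OF equiv that] by (simp add: rep_def)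
  have rep_eq: "rep v = rep w" if "(v, w) \<in> ?R" for v w
    using equiv_class_eq[OF equiv that] by (simp add: rep_def)
  have rep_W: "rep ` ?W \<subseteq> ?W" using rep by (auto simp: word_relation_def)
  have "finite (rep ` ?W)" using finite_words[OF assms] by simp
  then obtain ts where ts: "set ts = rep ` ?W" "distinct ts" using finite_distinct_list by blast
  have ts_lists: "set ts \<subseteq> lists X" using ts(1) rep_W by (auto simp: words_def)
  have "length ts = card (?W // ?R)"
  proof -
    have "bij_betw (\<lambda>t. ?R `` {t}) (set ts) (?W // ?R)"
    proof (rule bij_betw_imageI)
      show "inj_on (\<lambda>t. ?R `` {t}) (set ts)"
      proof (rule inj_onI)
        fix s t assume "s \<in> set ts" "t \<in> set ts" and eq: "?R `` {s} = ?R `` {t}"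
        then obtain v w where vw: "s = rep v" "v \<in> ?W" "t = rep w" "w \<in> ?W" using ts(1) by auto
        then have "rep s = s" "rep t = t" using rep rep_eq by metis+
        then show "s = t" using eq by (simp add: rep_def)
      qed
      have "?R `` {rep w} = ?R `` {w}" if "w \<in> ?W" for w
        using equiv_class_eq[OF equiv rep[OF that]] by simp
      then show "(\<lambda>t. ?R `` {t}) ` set ts = ?W // ?R"
        by (auto simp: ts(1) quotient_def)
    qed
    then show ?thesis using bij_betw_same_card distinct_card[OF ts(2)] by metis
  qed
  moreover have "S.independent (scalars X r) (map (\<lambda>t. ?res (monomial t)) ts)"
  proof (rule independent_residue_monomials[OF ts_lists ts(2)])
    fix s t assume st: "s \<in> set ts" "t \<in> set ts" "(word_step X r)\<^sup>*\<^sup>* s t"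
    then obtain v w where vw: "s = rep v" "v \<in> ?W" "t = rep w" "w \<in> ?W" using ts(1) by auto
    then have "(s, t) \<in> ?R" using st(3) rep_W by (auto simp: word_relation_def)
    moreover have "rep s = s" "rep t = t" using vw rep rep_eq by metis+
    ultimately show "s = t" using rep_eq by metis
  qed
  moreover have "S.Span (scalars X r) (map (\<lambda>t. ?res (monomial t)) ts) = graded_component X r d"
    unfolding Span_residue_monomials[OF ts_lists] graded_component_def
  proof (intro equalityI image_subsetI)
    fix f :: "'x word \<Rightarrow>\<^sub>0 'k" assume "f \<in> {f. Poly_Mapping.keys f \<subseteq> Word ` set ts}"
    then have keys: "Poly_Mapping.keys f \<subseteq> Word ` set ts" by simp
    have "length (letters w) = d" if w: "w \<in> Poly_Mapping.keys f" for w
    proof -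
      obtain t where "w = Word t" "t \<in> set ts" using w keys by blast
      then show ?thesis using ts(1) rep_W by (auto simp: words_def)
    qed
    then have "f \<in> homogeneous X d"
      using supported_mem_free_algebra[OF keys ts_lists] by (simp add: homogeneous_def)
    then show "?res f \<in> ?res ` homogeneous X d" by blast
  next
    fix f :: "'x word \<Rightarrow>\<^sub>0 'k" assume f: "f \<in> homogeneous X d"
    let ?g = "\<Sum>w\<in>Poly_Mapping.keys f. Poly_Mapping.single (Word (rep (letters w))) (Poly_Mapping.lookup f w)"
    have W: "letters w \<in> ?W" if "w \<in> Poly_Mapping.keys f" for w
      using f that by (auto simp: homogeneous_def mem_free_algebra_iff words_def)
    have g: "Poly_Mapping.keys ?g \<subseteq> Word ` set ts"
      using W by (intro order_trans[OF keys_sum]) (auto simp: ts(1) split: if_splits)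
    have "Poly_Mapping.single w (Poly_Mapping.lookup f w) - Poly_Mapping.single (Word (rep (letters w))) (Poly_Mapping.lookup f w)
        \<in> relation_ideal X r" if "w \<in> Poly_Mapping.keys f" for w
    proof -
      have "(word_step X r)\<^sup>*\<^sup>* (letters w) (rep (letters w))"
        using rep[OF W[OF that]] by (simp add: word_relation_def)
      then have "Poly_Mapping.single 0 (Poly_Mapping.lookup f w) * (monomial (letters w) - monomial (rep (letters w)))
          \<in> relation_ideal X r"
        by (intro relation_ideal_closed word_steps_imp_diff_mem single_mem_free_algebra)
          (simp_all add: zero_word_def)
      then show ?thesis by (simp add: monomial_def right_diff_distrib mult_single)
    qed
    then have "(\<Sum>w\<in>Poly_Mapping.keys f. Poly_Mapping.single w (Poly_Mapping.lookup f w)) - ?g \<in> relation_ideal X r"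
      by (simp add: relation_ideal_sum flip: sum_subtractf)
    then have "f - ?g \<in> relation_ideal X r" by (simp flip: poly_mapping_eq_sum_single)
    moreover have "f \<in> carrier (free_algebra X)" using f by (simp add: homogeneous_def)
    moreover have "?g \<in> carrier (free_algebra X)"
      using g ts_lists by (rule supported_mem_free_algebra)
    ultimately have "?res f = ?res ?g" using residue_class_eq_iff by blast
    then show "?res f \<in> ?res ` {f. Poly_Mapping.keys f \<subseteq> Word ` set ts}" using g by blast
  qed
  ultimately show ?thesis using S.dimensionI[OF subfield_scalars] by fastforce
qed

end

section \<open>Words of length three\<close>

lemma card_quotient_bij_betw:
  assumes f: "bij_betw f A B" and R: "R \<subseteq> A \<times> A" and S: "S \<subseteq> B \<times> B"
    and iff: "\<And>x y. x \<in> A \<Longrightarrow> y \<in> A \<Longrightarrow> (x, y) \<in> R \<longleftrightarrow> (f x, f y) \<in> S"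
  shows "card (A // R) = card (B // S)"
proof -
  have image: "f ` (R `` {x}) = S `` {f x}" if x: "x \<in> A" for x
  proof (intro equalityI subsetI)
    fix z assume "z \<in> f ` (R `` {x})"
    then show "z \<in> S `` {f x}" using R iff x by blast
  next
    fix z assume z: "z \<in> S `` {f x}"
    then obtain y where "y \<in> A" "z = f y" using S bij_betw_imp_surj_on[OF f] by blast
    then show "z \<in> f ` (R `` {x})" using z iff x by blast
  qed
  have "inj_on (image f) (A // R)"
    using inj_on_image_Pow[OF bij_betw_imp_inj_on[OF f]]
    by (rule inj_on_subset) (use R in \<open>auto simp: quotient_def\<close>)
  moreover have "image f ` (A // R) = B // S"
    unfolding quotient_def bij_betw_imp_surj_on[OF f, symmetric] using image by (simp add: image_UN)
  ultimately show ?thesis using card_image by metis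
qed

lemma six_times_choose_three: "6 * ((n + 2) choose 3) = n * (n + 1) * (n + 2)"
proof (induction n)
  case (Suc n)
  have "(Suc n + 2) choose 3 = ((n + 2) choose 2) + ((n + 2) choose 3)"
    by (simp add: numeral_3_eq_3 numeral_2_eq_2)
  moreover have "2 * ((n + 2) choose 2) = (n + 2) * (n + 1)"
    by (simp add: choose_two)
  ultimately show ?case using Suc by (simp add: algebra_simps)
qed simp

fun triple_word :: "'x \<times> 'x \<times> 'x \<Rightarrow> 'x list" where
  "triple_word (x, y, z) = [x, y, z]"

lemma bij_betw_triple_word: "bij_betw triple_word (X \<times> X \<times> X) (words X 3)"
proof (rule bij_betw_imageI)
  show "triple_word ` (X \<times> X \<times> X) = words X 3"
  proof (intro equalityI subsetI)
    fix w assume w: "w \<in> words X 3"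
    then obtain x y z where "w = [x, y, z]"
      by (auto simp: words_def numeral_3_eq_3 length_Suc_conv)
    then have "w = triple_word (x, y, z)" "(x, y, z) \<in> X \<times> X \<times> X" using w by (auto simp: words_def)
    then show "w \<in> triple_word ` (X \<times> X \<times> X)" by blast
  qed (auto simp: words_def)
qed (auto simp: inj_on_def)

context involutive_quadratic_set
begin

lemma r12_closed_involutive:
  assumes "t \<in> X \<times> X \<times> X"
  shows "r12 r t \<in> X \<times> X \<times> X" and "r12 r (r12 r t) = t"
proof -
  obtain x y z where t: "t = (x, y, z)" and xyz: "x \<in> X" "y \<in> X" "z \<in> X" using assms by auto
  obtain a b where ab: "r (x, y) = (a, b)" by fastforce
  show "r12 r t \<in> X \<times> X \<times> X"
    using r_closed[OF xyz(1,2) ab] xyz by (simp add: t r12_def ab)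
  show "r12 r (r12 r t) = t"
    using r_r[OF xyz(1,2)] by (simp add: t r12_def ab)
qed

lemma r23_closed_involutive:
  assumes "t \<in> X \<times> X \<times> X"
  shows "r23 r t \<in> X \<times> X \<times> X" and "r23 r (r23 r t) = t"
proof -
  obtain x y z where t: "t = (x, y, z)" and xyz: "x \<in> X" "y \<in> X" "z \<in> X" using assms by auto
  obtain a b where ab: "r (y, z) = (a, b)" by fastforce
  show "r23 r t \<in> X \<times> X \<times> X"
    using r_closed[OF xyz(2,3) ab] xyz by (simp add: t r23_def ab)
  show "r23 r (r23 r t) = t"
    using r_r[OF xyz(2,3)] by (simp add: t r23_def ab)
qed

lemmas r12_closed = r12_closed_involutive(1) and r12_r12 = r12_closed_involutive(2)
lemmas r23_closed = r23_closed_involutive(1) and r23_r23 = r23_closed_involutive(2)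

text \<open>
  A pair of adjacent letters in a word of length three is either the first or the last two.
\<close>

lemma word_step_triple_word:
  assumes "t \<in> X \<times> X \<times> X"
  shows "word_step X r (triple_word t) w \<longleftrightarrow>
    w = triple_word (r12 r t) \<or> w = triple_word (r23 r t)"
proof -
  obtain x y z where t: "t = (x, y, z)" and xyz: "x \<in> X" "y \<in> X" "z \<in> X" using assms by auto
  obtain a b c d where ab: "r (x, y) = (a, b)" and cd: "r (y, z) = (c, d)" by fastforce
  show ?thesis
  proof
    assume "word_step X r (triple_word t) w"
    then show "w = triple_word (r12 r t) \<or> w = triple_word (r23 r t)"
      by (cases rule: word_stepE) (auto simp: t r12_def r23_def Cons_eq_append_conv)
  next
    assume "w = triple_word (r12 r t) \<or> w = triple_word (r23 r t)"
    then show "word_step X r (triple_word t) w"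
      using word_stepI[of "[]" X "[z]" x y r a b] word_stepI[of "[x]" X "[]" y z r c d] xyz ab cd
      by (auto simp: t r12_def r23_def)
  qed
qed

lemma word_steps_triple_word:
  assumes s: "s \<in> X \<times> X \<times> X"
  shows "(word_step X r)\<^sup>*\<^sup>* (triple_word s) w \<longleftrightarrow>
    (\<exists>t\<in>X \<times> X \<times> X. w = triple_word t \<and> (\<lambda>s t. t = r12 r s \<or> t = r23 r s)\<^sup>*\<^sup>* s t)"
    (is "?L w \<longleftrightarrow> ?R w")
proof
  show "?L w \<Longrightarrow> ?R w"
  proof (induction rule: rtranclp_induct)
    case base
    then show ?case using s by blast
  next
    case (step v w)
    then obtain t where t: "t \<in> X \<times> X \<times> X" "v = triple_word t"
      "(\<lambda>s t. t = r12 r s \<or> t = r23 r s)\<^sup>*\<^sup>* s t" by blast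
    from step.hyps(2) obtain u where u: "w = triple_word u" "u = r12 r t \<or> u = r23 r t"
      unfolding t(2) word_step_triple_word[OF t(1)] by blast
    have "u \<in> X \<times> X \<times> X"
      using u(2) r12_closed[OF t(1)] r23_closed[OF t(1)] by (elim disjE) simp_all
    moreover have "(\<lambda>s t. t = r12 r s \<or> t = r23 r s)\<^sup>*\<^sup>* s u"
      using t(3) u(2) by (rule rtranclp.rtrancl_into_rtrancl)
    ultimately show ?case
      using u(1) by (intro bexI[of _ u] conjI)
  qed
next
  assume "?R w"
  then obtain t where w: "w = triple_word t"
    and reach: "(\<lambda>s t. t = r12 r s \<or> t = r23 r s)\<^sup>*\<^sup>* s t" by blast
  have "t \<in> X \<times> X \<times> X \<and> ?L (triple_word t)"
    using reach
  proof (induction rule: rtranclp_induct)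
    case (step t u)
    then have t: "t \<in> X \<times> X \<times> X" by blast
    have "word_step X r (triple_word t) (triple_word u)"
      unfolding word_step_triple_word[OF t] using step.hyps(2) by (elim disjE) simp_all
    moreover have "u \<in> X \<times> X \<times> X"
      using step.hyps(2) r12_closed[OF t] r23_closed[OF t] by (elim disjE) simp_all
    ultimately show ?case
      using step.IH rtranclp.rtrancl_into_rtrancl[of "word_step X r" _ "triple_word t" "triple_word u"]
      by blast
  qed (use s in simp)
  then show "?L w" by (simp add: w)
qed

lemma card_word_classes_3:
  "card (words X 3 // word_relation X r 3) =
    card ((X \<times> X \<times> X) // orbit_relation (X \<times> X \<times> X) (r12 r) (r23 r))"
proof (rule card_quotient_bij_betw[OF bij_betw_triple_word, symmetric])
  let ?T = "X \<times> X \<times> X"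
  fix s t assume s: "s \<in> ?T" and t: "t \<in> ?T"
  have inj: "triple_word t = triple_word u \<longleftrightarrow> t = u" if "u \<in> ?T" for u
    using inj_on_eq_iff[OF bij_betw_imp_inj_on[OF bij_betw_triple_word] t that] .
  have "triple_word s \<in> words X 3" "triple_word t \<in> words X 3"
    using s t bij_betw_triple_word bij_betwE by metis+
  then show "(s, t) \<in> orbit_relation ?T (r12 r) (r23 r) \<longleftrightarrow>
      (triple_word s, triple_word t) \<in> word_relation X r 3"
    using s t inj by (auto simp: orbit_relation_def word_relation_def word_steps_triple_word[OF s])
qed (auto simp: orbit_relation_def word_relation_def)

end

locale finite_quantum_binomial_set = involutive_quadratic_set +
  assumes finite: "finite X"
    and left_inj: "\<And>x y z. x \<in> X \<Longrightarrow> y \<in> X \<Longrightarrow> z \<in> X \<Longrightarrow> fst (r (x, y)) = fst (r (x, z)) \<Longrightarrow> y = z"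
    and right_inj: "\<And>x y z. x \<in> X \<Longrightarrow> y \<in> X \<Longrightarrow> z \<in> X \<Longrightarrow> snd (r (x, z)) = snd (r (y, z)) \<Longrightarrow> x = y"
    and diagonal: "\<And>x. x \<in> X \<Longrightarrow> r (x, x) = (x, x)"
begin

lemma fixed_iff_diagonal: "x \<in> X \<Longrightarrow> y \<in> X \<Longrightarrow> r (x, y) = (x, y) \<longleftrightarrow> x = y"
  using left_inj[of x y x] diagonal[of x] by auto

lemma r12_fixed_iff: "x \<in> X \<Longrightarrow> y \<in> X \<Longrightarrow> r12 r (x, y, z) = (x, y, z) \<longleftrightarrow> x = y"
  using fixed_iff_diagonal[of x y] by (auto simp: r12_def split: prod.splits)

lemma r23_fixed_iff: "y \<in> X \<Longrightarrow> z \<in> X \<Longrightarrow> r23 r (x, y, z) = (x, y, z) \<longleftrightarrow> y = z"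
  using fixed_iff_diagonal[of y z] by (auto simp: r23_def split: prod.splits)

text \<open>
  Let \<open>r(x,y) = (a,b)\<close> and \<open>r(y,z) = (c,d)\<close>. Equating the outer
  entries of \<open>r\<^sup>1\<^sup>2 r\<^sup>2\<^sup>3 (x,y,z)\<close> and \<open>r\<^sup>2\<^sup>3 r\<^sup>1\<^sup>2 (x,y,z)\<close>, the first
  entry of \<open>r(x,c)\<close> is \<open>a\<close> and the second entry of \<open>r(b,z)\<close> is \<open>d\<close>. Nondegeneracy
  then gives \<open>c = y = b\<close>. Comparing with \<open>r(y,y) = (y,y)\<close>, nondegeneracy gives \<open>x = y = z\<close>.
\<close>

sublocale triples: rigid_involutions "X \<times> X \<times> X" "r12 r" "r23 r"
proof
  fix t assume t: "t \<in> X \<times> X \<times> X" and comm: "r12 r (r23 r t) = r23 r (r12 r t)"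
  obtain x y z where t_eq: "t = (x, y, z)" and xyz: "x \<in> X" "y \<in> X" "z \<in> X" using t by auto
  obtain a b c d where ab: "r (x, y) = (a, b)" and cd: "r (y, z) = (c, d)" by fastforce
  have X: "a \<in> X" "b \<in> X" "c \<in> X" "d \<in> X"
    using r_closed[OF _ _ ab] r_closed[OF _ _ cd] xyz by auto
  have "fst (r (x, c)) = a" "snd (r (b, z)) = d"
    using comm by (simp_all add: t_eq r12_def r23_def ab cd prod_eq_iff case_prod_beta)
  then have "y = c" "y = b"
    using left_inj[of x y c] right_inj[of y b z] xyz X ab cd by auto
  then have "z = y" "x = y"
    using left_inj[of y z y] right_inj[of x y y] diagonal[of y] xyz ab cd by auto
  then show "r12 r t = t \<and> r23 r t = t"
    using r12_fixed_iff r23_fixed_iff xyz by (auto simp: t_eq)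
qed (simp_all add: finite r12_closed_involutive r23_closed_involutive del: mem_Sigma_iff)

text \<open>
  The total weight is \<open>2 n\<^sup>3 + 6 n\<^sup>2 + 4 n = 2 n (n + 1) (n + 2)\<close>.
\<close>

lemma weighted_count:
  defines "T \<equiv> X \<times> X \<times> X"
  shows "2 * card T + 3 * card {t \<in> T. r12 r t = t} + 3 * card {t \<in> T. r23 r t = t}
    + 4 * card {t \<in> T. r12 r t = t \<and> r23 r t = t} = 12 * ((card X + 2) choose 3)"
proof -
  have "{t \<in> T. r12 r t = t} = (\<lambda>(x, z). (x, x, z)) ` (X \<times> X)"
    using r12_fixed_iff by (auto simp: T_def image_iff)
  then have "card {t \<in> T. r12 r t = t} = card X * card X"
    by (simp add: card_image inj_on_def card_cartesian_product)
  moreover have "{t \<in> T. r23 r t = t} = (\<lambda>(x, z). (x, z, z)) ` (X \<times> X)"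
    using r23_fixed_iff by (auto simp: T_def image_iff)
  then have "card {t \<in> T. r23 r t = t} = card X * card X"
    by (simp add: card_image inj_on_def card_cartesian_product)
  moreover have "{t \<in> T. r12 r t = t \<and> r23 r t = t} = (\<lambda>x. (x, x, x)) ` X"
    using r12_fixed_iff r23_fixed_iff by (auto simp: T_def image_iff)
  then have "card {t \<in> T. r12 r t = t \<and> r23 r t = t} = card X"
    by (simp add: card_image inj_on_def)
  moreover have "card T = card X * (card X * card X)"
    by (simp add: T_def card_cartesian_product)
  ultimately show ?thesis
    using six_times_choose_three[of "card X"] by (simp add: algebra_simps)
qed

theorem braided_iff_card_word_classes:
  "braided X r \<longleftrightarrow> card (words X 3 // word_relation X r 3) = (card X + 2) choose 3"
proof -
  have "braided X r \<longleftrightarrow> 12 * card (words X 3 // word_relation X r 3) = 12 * ((card X + 2) choose 3)"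
    unfolding braided_def card_word_classes_3 triples.card_orbits_eq_iff_braid[symmetric] weighted_count ..
  then show ?thesis by simp
qed

end

lemma finite_quantum_binomial_setI:
  assumes "finite X" "quantum_binomial_set X r"
  shows "finite_quantum_binomial_set X r"
proof -
  note defs = quantum_binomial_set_def quadratic_set_def nondegenerate_def involutive_def square_free_def
  have closed: "r p \<in> X \<times> X" if "p \<in> X \<times> X" for p
    using assms(2) that bij_betwE unfolding defs by blast
  have left: "inj_on (\<lambda>y. fst (r (x, y))) X" and right: "inj_on (\<lambda>y. snd (r (y, x))) X"
    if "x \<in> X" for x
    using assms(2) that bij_betw_imp_inj_on unfolding defs by blast+
  show ?thesis
  proof
    show "y' \<in> X \<and> x' \<in> X" if "x \<in> X" "y \<in> X" "r (x, y) = (y', x')" for x y y' x'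
      using closed[of "(x, y)"] that by simp
    show "y = z" if "x \<in> X" "y \<in> X" "z \<in> X" "fst (r (x, y)) = fst (r (x, z))" for x y z
      using inj_onD[OF left] that by blast
    show "x = y" if "x \<in> X" "y \<in> X" "z \<in> X" "snd (r (x, z)) = snd (r (y, z))" for x y z
      using inj_onD[OF right] that by blast
  qed (use assms in \<open>auto simp: defs\<close>)
qed

theorem corollary4p9:
  fixes X :: "'x set" and r :: "'x \<times> 'x \<Rightarrow> 'x \<times> 'x" and n :: nat
  assumes "finite X" and "card X = n" and "quantum_binomial_set X r"
  shows "symmetric_set X r \<longleftrightarrow>
    ring.dimension (quadratic_algebra X r :: ('x word \<Rightarrow>\<^sub>0 'k::field) set ring)
      ((n + 2) choose 3) (scalars X r) (graded_component X r 3)"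
proof -
  interpret finite_quantum_binomial_set X r
    using assms(1,3) by (rule finite_quantum_binomial_setI)
  interpret ring_hom_ring "free_algebra X" "quadratic_algebra X r :: ('x word \<Rightarrow>\<^sub>0 'k) set ring"
    "residue_class X r"
    by (rule ring_hom_residue_class)
  let ?N = "card (words X 3 // word_relation X r 3)"
  have dim: "S.dimension ?N (scalars X r) (graded_component X r 3)"
    using assms(1) by (rule dimension_graded_component)
  have "symmetric_set X r \<longleftrightarrow> braided X r"
    using assms(3) by (auto simp: symmetric_set_def quantum_binomial_set_def)
  also have "\<dots> \<longleftrightarrow> ?N = (n + 2) choose 3"
    using braided_iff_card_word_classes assms(2) by simp
  also have "\<dots> \<longleftrightarrow> S.dimension ((n + 2) choose 3) (scalars X r) (graded_component X r 3)"
  proof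
    assume "?N = (n + 2) choose 3"
    with dim show "S.dimension ((n + 2) choose 3) (scalars X r) (graded_component X r 3)"
      by (rule subst[rotated])
  next
    assume "S.dimension ((n + 2) choose 3) (scalars X r) (graded_component X r 3)"
    with dim show "?N = (n + 2) choose 3"
      by (rule S.dimension_is_inj[OF subfield_scalars])
  qed
  finally show ?thesis .
qed

end
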